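(* Fix an integer $d\ge 2$. Then $M_k(d)=\Theta(k^{d})$ and $N_k(d)=\Theta(k^{d-1})$ as $k\to\infty$; that is, there are constants $0<c_d\le C_d$ depending only on $d$ such that for all $k\ge 1$, $c_dk^d\le M_k(d)\le C_dk^d$ and $c_dk^{d-1}\le N_k(d)\le C_dk^{d-1}$.
   Context: A set $P\subseteq\mathbb{R}^d$ is separated if $\|p_1-p_2\|\ge 1$ for all distinct $p_1,p_2\in P$. For $\varepsilon>0$, a separated set $P$ is an $\varepsilon$-nearly $k$-distance set (with distances $1\le t_1<\dots<t_k$) if $\|p_1-p_2\|\in\bigcup_{i=1}^k[t_i,t_i+\varepsilon]$ for all distinct $p_1,p_2\in P$. $M_k(d)$ is the largest $M$ such that for every $\varepsilon>0$ there is an $\varepsilon$-nearly $k$-distance set in $\mathbb{R}^d$ of cardinality $M$. Flatness: a $d$-plane is an affine subspace of dimension $d$. The angle between a vector $v$ and a plane $\Lambda$ is the infimum of the angles between $v$ and the vectors $w\in\Lambda-\Lambda$. A set of vectors $V$ is $(d,\alpha)$-flat with respect to a $d$-plane $\Lambda$ if the angle between every $v\in V$ and $\Lambda$ is at most $\alpha$. A set $P$ is $(p,d,\alpha)$-flat (for $p\in P$) with respect to a $d$-plane $\Lambda_p$ if $\{p-q:q\in P\}$ is $(d,\alpha)$-flat with respect to $\Lambda_p$; $P$ is $(d,\alpha)$-flat if for every $p\in P$ it is $(p,d,\alpha)$-flat with respect to some $d$-plane $\Lambda_p$. $N_k(d)$ (for $d\ge1$) is the largest $N$ such that for every $\varepsilon,\alpha>0$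 there exists a $(d-1,\alpha)$-flat $\varepsilon$-nearly $k$-distance set in $\mathbb{R}^{d}$ of cardinality $N$. *)

theory Defs
  imports "HOL-Analysis.Analysis"
begin

definition separated :: "'a::euclidean_space set \<Rightarrow> bool" where
  "separated P \<longleftrightarrow> (\<forall>p1\<in>P. \<forall>p2\<in>P. p1 \<noteq> p2 \<longrightarrow> dist p1 p2 \<ge> 1)"

definition nearly_k_distance :: "real \<Rightarrow> nat \<Rightarrow> 'a::euclidean_space set \<Rightarrow> bool" where
  "nearly_k_distance \<epsilon> k P \<longleftrightarrow> separated P \<and>
     (\<exists>t::nat \<Rightarrow> real. (\<forall>i<k. 1 \<le> t i) \<and> (\<forall>i j. i < j \<and> j < k \<longrightarrow> t i < t j) \<and>
        (\<forall>p1\<in>P. \<forall>p2\<in>P. p1 \<noteq> p2 \<longrightarrow>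
            (\<exists>i<k. t i \<le> dist p1 p2 \<and> dist p1 p2 \<le> t i + \<epsilon>)))"

definition M_achievable :: "nat \<Rightarrow> 'a::euclidean_space itself \<Rightarrow> nat \<Rightarrow> bool" where
  "M_achievable k _ M \<longleftrightarrow>
     (\<forall>\<epsilon>>0. \<exists>P::'a set. finite P \<and> card P = M \<and> nearly_k_distance \<epsilon> k P)"

definition M_num :: "nat \<Rightarrow> 'a::euclidean_space itself \<Rightarrow> nat" where
  "M_num k T = (GREATEST M. M_achievable k T M)"

definition vec_angle :: "'a::euclidean_space \<Rightarrow> 'a \<Rightarrow> real" where
  "vec_angle v w = arccos ((v \<bullet> w) / (norm v * norm w))"

definition angle_to_plane :: "'a::euclidean_space \<Rightarrow> 'a set \<Rightarrow> real" where
  "angle_to_plane v L =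
     (if v = 0 then 0 else Inf {vec_angle v w | w. w \<in> {x - y | x y. x \<in> L \<and> y \<in> L} \<and> w \<noteq> 0})"

definition is_plane :: "nat \<Rightarrow> 'a::euclidean_space set \<Rightarrow> bool" where
  "is_plane d L \<longleftrightarrow> affine L \<and> L \<noteq> {} \<and> aff_dim L = int d"

definition vectors_flat :: "nat \<Rightarrow> real \<Rightarrow> 'a::euclidean_space set \<Rightarrow> 'a set \<Rightarrow> bool" where
  "vectors_flat d \<alpha> V L \<longleftrightarrow> is_plane d L \<and> (\<forall>v\<in>V. angle_to_plane v L \<le> \<alpha>)"

definition flat_set :: "nat \<Rightarrow> real \<Rightarrow> 'a::euclidean_space set \<Rightarrow> bool" where
  "flat_set d \<alpha> P \<longleftrightarrow> (\<forall>p\<in>P. \<exists>L. vectors_flat d \<alpha> {p - q | q. q \<in> P} L)"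

definition N_achievable :: "nat \<Rightarrow> 'a::euclidean_space itself \<Rightarrow> nat \<Rightarrow> bool" where
  "N_achievable k _ N \<longleftrightarrow>
     (\<forall>\<epsilon>>0. \<forall>\<alpha>>0. \<exists>P::'a set. finite P \<and> card P = N \<and>
         flat_set (DIM('a) - 1) \<alpha> P \<and> nearly_k_distance \<epsilon> k P)"

definition N_num :: "nat \<Rightarrow> 'a::euclidean_space itself \<Rightarrow> nat" where
  "N_num k T = (GREATEST N. N_achievable k T N)"

end

theory Submission
  imports Defs
begin

text \<open>
  Upper bounds: let \<open>\<epsilon>\<close> (and \<open>\<alpha>\<close>) tend to 0 along a sequence of sets \<open>P\<close> of fixed cardinality for which
  all unit directions between points converge. Suppose that at each point the limit directions
  span dimension at most \<open>m\<close>. Rescale \<open>P\<close> by its diameter; the limit points span an affine space with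
  direction space \<open>V\<close> of dimension \<open>a \<ge> 1\<close>. Take \<open>a + 1\<close> affinely independent limit points as references.
  Sort the points of \<open>P\<close> by a reference \<open>\<beta>\<close> at which their barycentric coordinate is nonzero, by the
  sign of that coordinate, and by the intervals containing their distances to the other \<open>a\<close>
  references: \<open>O(k^a)\<close> classes. Within a class all limit directions are orthogonal to \<open>V\<close>, whereas \<open>V\<close> is
  contained in the span of the limit directions at every point of \<open>P\<close>. So each class has local
  dimension at most \<open>m - a\<close>, and induction gives \<open>card P = O(k^m)\<close>. Without flatness \<open>m = d\<close>, and
  flatness forces \<open>m = d - 1\<close>.

  Lower bounds: along orthogonal axes place grids with about \<open>k / d\<close> steps whose step lengths are of vastly
  different magnitudes. Each distance is then nearly a multiple of the step length of the coarsest axis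
  in which the two points differ. Using only \<open>d - 1\<close> axes gives sets inside a hyperplane.
\<close>

section \<open>Limits of configurations and their rescalings\<close>

text \<open>
  The values \<open>t\<^sub>i\<close> of the distances play no role in the limit: \<open>c q i\<close> only names the interval containing
  the distance from \<open>q\<close> to \<open>i\<close>, with a separate name for \<open>c q q\<close> (whence \<open>\<kappa> = k + 1\<close> later).
\<close>

definition configuration ::
  "'i set \<Rightarrow> (nat \<Rightarrow> 'i \<Rightarrow> 'a::euclidean_space) \<Rightarrow> ('i \<Rightarrow> 'i \<Rightarrow> nat) \<Rightarrow> nat \<Rightarrow> ('i \<Rightarrow> 'i \<Rightarrow> 'a) \<Rightarrow> bool" where
  "configuration I p c \<kappa> u \<longleftrightarrow> finite I \<and>
     (\<forall>n. \<forall>i\<in>I. \<forall>j\<in>I. i \<noteq> j \<longrightarrow> 1 \<le> dist (p n i) (p n j)) \<and>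
     (\<forall>q\<in>I. \<forall>i\<in>I. c q i < \<kappa>) \<and>
     (\<forall>q\<in>I. \<forall>i\<in>I. \<forall>j\<in>I. c q i = c q j \<longrightarrow>
        (\<lambda>n. dist (p n q) (p n i) - dist (p n q) (p n j)) \<longlonglongrightarrow> 0) \<and>
     (\<forall>i\<in>I. \<forall>j\<in>I. (\<lambda>n. sgn (p n j - p n i)) \<longlonglongrightarrow> u i j)"

lemma configuration_subset:
  assumes "configuration I p c \<kappa> u" "K \<subseteq> I"
  shows "configuration K p c \<kappa> u"
  using assms finite_subset[OF assms(2)] unfolding configuration_def by (simp add: subset_iff)

lemma finite_family_convergent_subseq:
  fixes f :: "'i \<Rightarrow> nat \<Rightarrow> 'b::heine_borel"
  assumes "finite I" "\<And>i. i \<in> I \<Longrightarrow> bounded (range (f i))"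
  shows "\<exists>r l. strict_mono (r::nat \<Rightarrow> nat) \<and> (\<forall>i\<in>I. (\<lambda>n. f i (r n)) \<longlonglongrightarrow> l i)"
  using assms
proof (induction I rule: finite_induct)
  case empty
  show ?case using strict_mono_id by auto
next
  case (insert i I)
  then obtain r l where r: "strict_mono r" "\<forall>j\<in>I. (\<lambda>n. f j (r n)) \<longlonglongrightarrow> l j" by auto
  have "bounded (range (\<lambda>n. f i (r n)))"
    using insert.prems[of i] by (auto intro: bounded_subset)
  then obtain l' r' where r': "strict_mono r'" "((\<lambda>n. f i (r n)) \<circ> r') \<longlonglongrightarrow> l'"
    using bounded_imp_convergent_subsequence by blast
  have "(\<lambda>n. f j (r (r' n))) \<longlonglongrightarrow> (l(i := l')) j" if "j \<in> insert i I" for j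
  proof (cases "j = i")
    case True
    then show ?thesis using r' by (simp add: o_def)
  next
    case False
    then show ?thesis
      using LIMSEQ_subseq_LIMSEQ[OF r(2)[rule_format, of j] r'(1)] that by (simp add: o_def)
  qed
  moreover have "strict_mono (r \<circ> r')" using r r' by (rule_tac strict_mono_o)
  ultimately show ?case
    by (intro exI[of _ "r \<circ> r'"] exI[of _ "l(i := l')"]) (simp add: o_def)
qed

text \<open>
  The orthogonality relation is the limit of
  \<open>(p\<^sub>j - p\<^sub>i) \<bullet> (p\<^sub>i + p\<^sub>j - 2 p\<^sub>q) = \<bar>p\<^sub>j - p\<^sub>q\<bar>\<^sup>2 - \<bar>p\<^sub>i - p\<^sub>q\<bar>\<^sup>2\<close>, divided by \<open>\<bar>p\<^sub>j - p\<^sub>i\<bar> \<ge> 1\<close> and by the scale.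
\<close>

lemma configuration_rescaled_limit:
  assumes conf: "configuration I p c \<kappa> u" and ij: "i0 \<in> I" "j0 \<in> I" "i0 \<noteq> j0"
  obtains x where "\<exists>i\<in>I. \<exists>j\<in>I. x i \<noteq> x j"
    "\<And>i j. i \<in> I \<Longrightarrow> j \<in> I \<Longrightarrow> x j - x i = norm (x j - x i) *\<^sub>R u i j"
    "\<And>q i j. q \<in> I \<Longrightarrow> i \<in> I \<Longrightarrow> j \<in> I \<Longrightarrow> c q i = c q j \<Longrightarrow> 
       u i j \<bullet> (x i + x j - 2 *\<^sub>R x q) = 0"
proof -
  have fin: "finite I"
    and sep: "\<And>n i j. i \<in> I \<Longrightarrow> j \<in> I \<Longrightarrow> i \<noteq> j \<Longrightarrow> 1 \<le> dist (p n i) (p n j)"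
    and cl: "\<And>q i j. q \<in> I \<Longrightarrow> i \<in> I \<Longrightarrow> j \<in> I \<Longrightarrow> c q i = c q j \<Longrightarrow> 
        (\<lambda>n. dist (p n q) (p n i) - dist (p n q) (p n j)) \<longlonglongrightarrow> 0"
    and u: "\<And>i j. i \<in> I \<Longrightarrow> j \<in> I \<Longrightarrow> (\<lambda>n. sgn (p n j - p n i)) \<longlonglongrightarrow> u i j"
    using conf unfolding configuration_def by blast+
  \<comment> \<open>The sum of all distances is a scale comparable to the diameter. The rescaled
    distances then sum to exactly 1, so the limit points cannot all coincide.\<close>
  define D where "D n = (\<Sum>(i,j)\<in>I\<times>I. dist (p n i) (p n j))" for n
  have D_ge: "dist (p n i) (p n j) \<le> D n" if "i \<in> I" "j \<in> I" for n i j
    unfolding D_def using member_le_sum[of "(i,j)" "I \<times> I" "\<lambda>(i,j). dist (p n i) (p n j)"] fin that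
    by auto
  have D1: "1 \<le> D n" for n
    using D_ge[OF ij(1,2), of n] sep[OF ij, of n] by linarith
  have D0: "0 < D n" for n using D1[of n] by linarith
  define y where "y i n = (p n i - p n i0) /\<^sub>R D n" for i n
  have yd: "y j n - y i n = (p n j - p n i) /\<^sub>R D n" for i j n
    by (simp add: y_def algebra_simps)
  have ydist: "dist (y i n) (y j n) = dist (p n i) (p n j) / D n" for i j n
    using D0[of n] by (simp add: dist_norm yd divide_inverse mult.commute)
  have "norm (y i n) \<le> 1" if "i \<in> I" for i n
    using D_ge[OF that ij(1), of n] D0[of n] by (simp add: y_def dist_norm divide_simps)
  then have "bounded (range (y i))" if "i \<in> I" for i
    using that by (auto simp: bounded_iff)
  with finite_family_convergent_subseq[OF fin, of y]
  obtain r x where r: "strict_mono r" and x: "\<And>i. i \<in> I \<Longrightarrow> (\<lambda>n. y i (r n)) \<longlonglongrightarrow> x i"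
    by blast
  have ur: "(\<lambda>n. sgn (p (r n) j - p (r n) i)) \<longlonglongrightarrow> u i j" if "i \<in> I" "j \<in> I" for i j
    using LIMSEQ_subseq_LIMSEQ[OF u[OF that] r] by (simp add: o_def)
  show ?thesis
  proof
    show "\<exists>i\<in>I. \<exists>j\<in>I. x i \<noteq> x j"
    proof (rule ccontr)
      assume "\<not> ?thesis"
      then have eq: "x i = x j" if "i \<in> I" "j \<in> I" for i j using that by blast
      have "(\<lambda>n. \<Sum>(i,j)\<in>I\<times>I. dist (y i (r n)) (y j (r n))) \<longlonglongrightarrow> (\<Sum>(i,j)\<in>I\<times>I. dist (x i) (x j))"
        by (auto simp: case_prod_beta intro!: tendsto_sum tendsto_dist x)
      moreover have "(\<Sum>(i,j)\<in>I\<times>I. dist (x i) (x j)) = 0"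
        by (rule sum.neutral) (auto intro: eq)
      moreover have "(\<Sum>(i,j)\<in>I\<times>I. dist (y i n) (y j n)) = 1" for n
        using D0[of n]
        by (simp add: ydist case_prod_beta flip: sum_divide_distrib) (simp add: D_def case_prod_beta)
      ultimately show False by (simp add: LIMSEQ_const_iff)
    qed
  next
    fix i j assume i: "i \<in> I" and j: "j \<in> I"
    have s: "sgn (y j n - y i n) = sgn (p n j - p n i)" for n
      using D0[of n] by (simp add: yd sgn_scaleR)
    have l: "(\<lambda>n. y j (r n) - y i (r n)) \<longlonglongrightarrow> x j - x i"
      using x i j by (intro tendsto_diff) auto
    have "(\<lambda>n. norm (y j (r n) - y i (r n)) *\<^sub>R sgn (y j (r n) - y i (r n)))
        \<longlonglongrightarrow> norm (x j - x i) *\<^sub>R u i j"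
      unfolding s by (intro tendsto_scaleR tendsto_norm l ur i j)
    moreover have "norm (y j n - y i n) *\<^sub>R sgn (y j n - y i n) = y j n - y i n" for n
      by (cases "y j n - y i n = 0") (simp_all only: sgn_div_norm, simp_all)
    ultimately have "(\<lambda>n. y j (r n) - y i (r n)) \<longlonglongrightarrow> norm (x j - x i) *\<^sub>R u i j"
      by (simp only:)
    with l show "x j - x i = norm (x j - x i) *\<^sub>R u i j"
      by (rule LIMSEQ_unique)
  next
    fix q i j assume q: "q \<in> I" and i: "i \<in> I" and j: "j \<in> I" and c: "c q i = c q j"
    define \<delta> where "\<delta> n = dist (p n q) (p n i) - dist (p n q) (p n j)" for n
    show "u i j \<bullet> (x i + x j - 2 *\<^sub>R x q) = 0"
    proof (cases "i = j")
      case True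
      then show ?thesis using LIMSEQ_unique[OF u[OF i j]] by (simp add: LIMSEQ_const_iff)
    next
      case False
      have \<delta>: "\<delta> \<longlonglongrightarrow> 0" using cl[OF q i j c] unfolding \<delta>_def[abs_def] .
      have eq: "sgn (p n j - p n i) \<bullet> (y i n + y j n - 2 *\<^sub>R y q n)
          = - \<delta> n * (dist (y q n) (y i n) + dist (y q n) (y j n)) / dist (p n i) (p n j)" for n
      proof -
        have "(p n j - p n i) \<bullet> ((p n i - p n q) + (p n j - p n q))
            = (dist (p n q) (p n j))\<^sup>2 - (dist (p n q) (p n i))\<^sup>2"
          by (simp add: dist_norm power2_norm_eq_inner algebra_simps inner_commute)
        also have "\<dots> = - \<delta> n * (dist (p n q) (p n i) + dist (p n q) (p n j))"
          by (simp add: \<delta>_def power2_eq_square algebra_simps)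
        finally have 1: "(p n j - p n i) \<bullet> ((p n i - p n q) + (p n j - p n q)) = \<dots>" .
        have "y i n + y j n - 2 *\<^sub>R y q n = (y i n - y q n) + (y j n - y q n)"
          by (simp add: algebra_simps scaleR_2)
        also have "\<dots> = ((p n i - p n q) + (p n j - p n q)) /\<^sub>R D n"
          by (simp add: yd scaleR_right_distrib)
        finally have "sgn (p n j - p n i) \<bullet> (y i n + y j n - 2 *\<^sub>R y q n)
           = ((p n j - p n i) \<bullet> ((p n i - p n q) + (p n j - p n q))) / D n / dist (p n i) (p n j)"
          by (simp add: sgn_div_norm dist_norm norm_minus_commute divide_inverse)
        also have "\<dots> = - \<delta> n * (dist (y q n) (y i n) + dist (y q n) (y j n)) / dist (p n i) (p n j)"
          unfolding 1 ydist by (simp add: divide_inverse algebra_simps)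
        finally show ?thesis .
      qed
      have lim0: "(\<lambda>n. - \<delta> (r n) * (dist (y q (r n)) (y i (r n)) + dist (y q (r n)) (y j (r n)))
          / dist (p (r n) i) (p (r n) j)) \<longlonglongrightarrow> 0"
      proof (rule Lim_null_comparison)
        have "(\<lambda>n. \<bar>\<delta> (r n)\<bar> * (dist (y q (r n)) (y i (r n)) + dist (y q (r n)) (y j (r n)))) \<longlonglongrightarrow>
            \<bar>0\<bar> * (dist (x q) (x i) + dist (x q) (x j))"
          using LIMSEQ_subseq_LIMSEQ[OF \<delta> r]
          by (intro tendsto_mult tendsto_add tendsto_dist tendsto_rabs x q i j) (simp add: o_def)
        then show "(\<lambda>n. \<bar>\<delta> (r n)\<bar> * (dist (y q (r n)) (y i (r n)) + dist (y q (r n)) (y j (r n)))) \<longlonglongrightarrow> 0"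
          by simp
        have "a / d \<le> a" if "1 \<le> d" "0 \<le> a" for a d :: real
          using that by (simp add: divide_le_eq mult_left_le mult_le_cancel_left1)
        then show "\<forall>\<^sub>F n in sequentially. norm (- \<delta> (r n) * (dist (y q (r n)) (y i (r n)) + dist (y q (r n)) (y j (r n)))
          / dist (p (r n) i) (p (r n) j)) \<le> \<bar>\<delta> (r n)\<bar> * (dist (y q (r n)) (y i (r n)) + dist (y q (r n)) (y j (r n)))"
          using sep[OF i j False] by (intro always_eventually allI) (simp add: abs_mult)
      qed
      have "(\<lambda>n. sgn (p (r n) j - p (r n) i) \<bullet> (y i (r n) + y j (r n) - 2 *\<^sub>R y q (r n)))
         \<longlonglongrightarrow> u i j \<bullet> (x i + x j - 2 *\<^sub>R x q)"
        by (intro tendsto_inner ur tendsto_diff tendsto_add tendsto_scaleR tendsto_const x q i j)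
      then show ?thesis using lim0 unfolding eq by (rule LIMSEQ_unique)
    qed
  qed
qed

section \<open>Counting the points of a configuration\<close>

lemma card_le_card_keys_times:
  assumes "finite A" "finite T" "f ` A \<subseteq> T" "\<And>t. t \<in> T \<Longrightarrow> card {a \<in> A. f a = t} \<le> N"
  shows "card A \<le> card T * N"
proof -
  have "A = (\<Union>t\<in>T. {a \<in> A. f a = t})" using assms by auto
  then have "card A \<le> (\<Sum>t\<in>T. card {a \<in> A. f a = t})"
    using card_UN_le[OF assms(2), of "\<lambda>t. {a \<in> A. f a = t}"] by simp
  also have "\<dots> \<le> card T * N" using sum_bounded_above[of T _ N] assms(4) by simp
  finally show ?thesis .
qed

text \<open>Barycentric coordinates. Several indices may share one limit point, so \<open>J\<close>
  takes one index for each vector of a basis of the differences from \<open>x b\<close>, and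
  \<open>G\<close> adds \<open>b\<close>. Total weight 1 makes the representation valid for every
  origin \<open>z\<close>.\<close>

lemma ex_affine_reference_points:
  fixes x :: "'i \<Rightarrow> 'a::euclidean_space"
  assumes b: "b \<in> I" "finite I"
  obtains G \<mu> where "G \<subseteq> I" "card G = Suc (dim ((\<lambda>i. x i - x b) ` I))"
    "\<And>i. i \<in> I \<Longrightarrow> sum (\<mu> i) G = 1"
    "\<And>i z. i \<in> I \<Longrightarrow> x i - z = (\<Sum>l\<in>G. \<mu> i l *\<^sub>R (x l - z))"
proof -
  let ?f = "\<lambda>i. x i - x b"
  obtain B where B: "B \<subseteq> ?f ` I" "independent B" "?f ` I \<subseteq> span B" "card B = dim (?f ` I)"
    using basis_exists by blast
  then obtain J where J: "J \<subseteq> I" "inj_on ?f J" "B = ?f ` J"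
    by (meson subset_image_inj)
  have finJ: "finite J" using J(1) b(2) finite_subset by blast
  have bJ: "b \<notin> J"
  proof
    assume "b \<in> J"
    then have "?f b \<in> B" unfolding J(3) by (rule imageI)
    then show False using B(2) dependent_zero[of B] by simp
  qed
  have "\<exists>\<mu>. sum \<mu> (insert b J) = 1 \<and> (\<forall>z. x i - z = (\<Sum>l\<in>insert b J. \<mu> l *\<^sub>R (x l - z)))" if "i \<in> I" for i
  proof -
    have "?f i \<in> span (?f ` J)" using B(3) J(3) that by auto
    then obtain w where w: "?f i = (\<Sum>v\<in>?f ` J. w v *\<^sub>R v)"
      using span_finite[of "?f ` J"] finJ by auto
    define \<nu> where "\<nu> j = w (?f j)" for j
    have \<nu>: "?f i = (\<Sum>j\<in>J. \<nu> j *\<^sub>R ?f j)"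
      unfolding w \<nu>_def using J(2) by (simp add: sum.reindex)
    define \<mu> where "\<mu> l = (if l = b then 1 - sum \<nu> J else \<nu> l)" for l
    have \<mu>J: "(\<Sum>l\<in>J. \<mu> l *\<^sub>R g l) = (\<Sum>l\<in>J. \<nu> l *\<^sub>R g l)" for g :: "'i \<Rightarrow> 'a"
      using bJ by (intro sum.cong) (auto simp: \<mu>_def)
    have \<mu>J': "sum \<mu> J = sum \<nu> J"
      using bJ by (intro sum.cong) (auto simp: \<mu>_def)
    have "sum \<mu> (insert b J) = 1" using finJ bJ \<mu>J' by (simp add: \<mu>_def)
    moreover have "x i - z = (\<Sum>l\<in>insert b J. \<mu> l *\<^sub>R (x l - z))" for z
    proof -
      have "(\<Sum>l\<in>insert b J. \<mu> l *\<^sub>R (x l - z)) = \<mu> b *\<^sub>R (x b - z) + (\<Sum>l\<in>J. \<nu> l *\<^sub>R (?f l + (x b - z)))"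
        using finJ bJ \<mu>J[of "\<lambda>l. x l - z"] by simp
      also have "\<dots> = \<mu> b *\<^sub>R (x b - z) + ?f i + sum \<nu> J *\<^sub>R (x b - z)"
        unfolding \<nu> scaleR_right_distrib sum.distrib by (simp add: scaleR_sum_left)
      also have "\<dots> = x i - z" by (simp add: \<mu>_def algebra_simps)
      finally show ?thesis by simp
    qed
    ultimately show ?thesis by blast
  qed
  then have "\<exists>\<mu>. \<forall>i\<in>I. sum (\<mu> i) (insert b J) = 1 \<and>
      (\<forall>z. x i - z = (\<Sum>l\<in>insert b J. \<mu> i l *\<^sub>R (x l - z)))"
    by (intro bchoice) blast
  then obtain \<mu> where "\<And>i. i \<in> I \<Longrightarrow> sum (\<mu> i) (insert b J) = 1"
    "\<And>i z. i \<in> I \<Longrightarrow> x i - z = (\<Sum>l\<in>insert b J. \<mu> i l *\<^sub>R (x l - z))"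
    by blast
  moreover have "card (insert b J) = Suc (dim (?f ` I))"
    using finJ bJ B(4) card_image[OF J(2)] J(3) by simp
  ultimately show ?thesis using that[of "insert b J" \<mu>] J(1) b(1) by blast
qed

text \<open>Strong induction on the local dimension \<open>m\<close>. Two distinct indices force
  \<open>1 \<le> a\<close> and \<open>a \<le> m\<close>, so \<open>m = 0\<close> allows at most one
  point. Otherwise there are at most \<open>2 * (a + 1) * \<kappa> ^ a\<close> classes, each of
  local dimension at most \<open>m - a\<close>.\<close>

lemma configuration_card_le:
  fixes u :: "'i \<Rightarrow> 'i \<Rightarrow> 'a::euclidean_space"
  assumes "configuration I p c \<kappa> u" "\<And>i. i \<in> I \<Longrightarrow> dim (u i ` I) \<le> m" "1 \<le> \<kappa>"
  shows "card I \<le> (2 * (m + 1)) ^ m * \<kappa> ^ m"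
  using assms
proof (induction m arbitrary: I rule: less_induct)
  case (less m)
  have fin: "finite I" using less.prems(1) by (simp add: configuration_def)
  show ?case
  proof (cases "\<exists>i0\<in>I. \<exists>j0\<in>I. i0 \<noteq> j0")
    case False
    then have "card I \<le> Suc 0" using fin by (meson card_le_Suc0_iff_eq)
    also have "\<dots> \<le> (2 * (m + 1)) ^ m * \<kappa> ^ m" using less.prems(3) by simp
    finally show ?thesis .
  next
    case True
    then obtain i0 j0 where ij: "i0 \<in> I" "j0 \<in> I" "i0 \<noteq> j0" by blast
    obtain x where x1: "\<exists>i\<in>I. \<exists>j\<in>I. x i \<noteq> x j"
      and x2: "\<And>i j. i \<in> I \<Longrightarrow> j \<in> I \<Longrightarrow> x j - x i = norm (x j - x i) *\<^sub>R u i j"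
      and x3: "\<And>q i j. q \<in> I \<Longrightarrow> i \<in> I \<Longrightarrow> j \<in> I \<Longrightarrow> c q i = c q j \<Longrightarrow> 
         u i j \<bullet> (x i + x j - 2 *\<^sub>R x q) = 0"
      by (rule configuration_rescaled_limit[OF less.prems(1) ij]) blast
    define A where "A = (\<lambda>i. x i - x i0) ` I"
    define a where "a = dim A"
    obtain G \<mu> where G: "G \<subseteq> I" "card G = Suc a"
      and \<mu>1: "\<And>i. i \<in> I \<Longrightarrow> sum (\<mu> i) G = 1"
      and \<mu>: "\<And>i z. i \<in> I \<Longrightarrow> x i - z = (\<Sum>l\<in>G. \<mu> i l *\<^sub>R (x l - z))"
      unfolding a_def A_def by (rule ex_affine_reference_points[OF ij(1) fin, of x]) blast
    have finG: "finite G" using G(1) fin finite_subset by blast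
    have a_pos: "1 \<le> a"
    proof (rule ccontr)
      assume "\<not> ?thesis"
      then have "dim A = 0" unfolding a_def by linarith
      then have "A \<subseteq> {0}" by (simp only: dim_eq_0)
      then have "x i = x i0" if "i \<in> I" for i using that by (auto simp: A_def)
      then show False using x1 by metis
    qed
    \<comment> \<open>Each \<open>x l - x i\<close> is a multiple of \<open>u i l\<close>, so the
      global directions are present at every point \<open>i\<close>. This is why the dimension drops
      by \<open>a\<close> at all points of a class.\<close>
    have A_sub: "span A \<subseteq> span (u i ` I)" if i: "i \<in> I" for i
    proof (rule span_minimal)
      have *: "x l - x i \<in> span (u i ` I)" if "l \<in> I" for l
        by (subst x2[OF i that]) (intro span_scale span_base imageI that)
      show "A \<subseteq> span (u i ` I)"
      proof
        fix v assume "v \<in> A"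
        then obtain l where "l \<in> I" "v = (x l - x i) - (x i0 - x i)" by (auto simp: A_def)
        then show "v \<in> span (u i ` I)" using * ij(1) span_diff by blast
      qed
    qed simp
    have am: "a \<le> m"
      using dim_subset[OF A_sub[OF ij(1)]] less.prems(2)[OF ij(1)] by (simp add: a_def dim_span)
    have "\<exists>\<beta>\<in>G. \<mu> i \<beta> \<noteq> 0" if "i \<in> I" for i
      using \<mu>1[OF that] by (metis sum.neutral zero_neq_one)
    then obtain \<beta> where \<beta>: "\<And>i. i \<in> I \<Longrightarrow> \<beta> i \<in> G" "\<And>i. i \<in> I \<Longrightarrow> \<mu> i (\<beta> i) \<noteq> 0"
      by metis
    \<comment> \<open>Leaving \<open>\<beta> i\<close> out of the recorded distances keeps the
      exponent at \<open>a\<close> although there are \<open>a + 1\<close> references. The nonzero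
      coordinate at \<open>\<beta> i\<close>, with its sign, makes up for the omission.\<close>
    define key where "key i = (\<beta> i, \<mu> i (\<beta> i) > 0, restrict (\<lambda>q. c q i) (G - {\<beta> i}))" for i
    define T where "T = (SIGMA g:G. (UNIV::bool set) \<times> (PiE (G - {g}) (\<lambda>_. {..<\<kappa>})))"
    have finT: "finite T" unfolding T_def using finG by (intro finite_SigmaI finite_cartesian_product finite_PiE) auto
    have "card T = (\<Sum>g\<in>G. 2 * \<kappa> ^ a)"
    proof -
      have "card (PiE (G - {g}) (\<lambda>_. {..<\<kappa>})) = \<kappa> ^ a" if "g \<in> G" for g
        using that finG G(2) by (simp add: card_PiE)
      then show ?thesis unfolding T_def using finG
        by (subst card_SigmaI) (auto simp: card_cartesian_product finite_PiE)
    qed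
    then have cardT: "card T = 2 * (a + 1) * \<kappa> ^ a" using G(2) by simp
    have "\<forall>q\<in>I. \<forall>i\<in>I. c q i < \<kappa>"
      using less.prems(1) unfolding configuration_def by (elim conjE)
    then have c_less: "c q i < \<kappa>" if "q \<in> G" "i \<in> I" for q i
      using G(1) that by blast
    have keyT: "key ` I \<subseteq> T"
    proof
      fix t assume "t \<in> key ` I"
      then obtain i where "i \<in> I" "t = key i" by blast
      then show "t \<in> T"
        using \<beta>(1) c_less by (simp add: key_def T_def)
    qed
    have fiber: "card {i \<in> I. key i = t} \<le> (2 * (m - a + 1)) ^ (m - a) * \<kappa> ^ (m - a)" for t
    proof -
      define K where "K = {i \<in> I. key i = t}"
      have KI: "K \<subseteq> I" by (auto simp: K_def)
      \<comment> \<open>The inner product with \<open>u i j\<close> takes one value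
        \<open>h\<close>, the mean of its values at \<open>x i\<close> and \<open>x j\<close>, on
        all references but \<open>g\<close>. Expanding \<open>x i + x j - 2 *\<^sub>R x q0\<close>
        over \<open>G\<close> leaves only the \<open>g\<close> term, so the value at
        \<open>g\<close> is \<open>h\<close> too. It is then constant on all limit points, hence
        zero on \<open>A\<close>.\<close>
      have orth: "u i j \<bullet> v = 0" if i: "i \<in> K" and j: "j \<in> K" and v: "v \<in> A" for i j v
      proof -
        have iI: "i \<in> I" and jI: "j \<in> I" using i j by (auto simp: K_def)
        have k: "key i = key j" using i j by (auto simp: K_def)
        define g where "g = \<beta> i"
        have g: "g \<in> G" "\<beta> j = g" using k \<beta>(1)[OF iI] by (auto simp: key_def g_def)
        have pos: "\<mu> i g > 0 \<longleftrightarrow> \<mu> j g > 0" "\<mu> i g \<noteq> 0" "\<mu> j g \<noteq> 0"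
          using k \<beta>(2)[OF iI] \<beta>(2)[OF jI] g by (auto simp: key_def g_def)
        \<comment> \<open>The sign in the key rules out that \<open>i\<close> and \<open>j\<close> lie on opposite sides of the face missing \<open>g\<close>.\<close>
        then have nz: "\<mu> i g + \<mu> j g \<noteq> 0" by linarith
        have res: "restrict (\<lambda>q. c q i) (G - {g}) q = restrict (\<lambda>q. c q j) (G - {g}) q" for q
          using k g(2) by (simp add: key_def g_def)
        have cq: "c q i = c q j" if "q \<in> G - {g}" for q
          using res[of q] that by simp
        define h where "h = (u i j \<bullet> x i + u i j \<bullet> x j) / 2"
        have hq: "u i j \<bullet> x q = h" if "q \<in> G - {g}" for q
          using x3[OF _ iI jI cq[OF that]] that G(1)
          by (force simp: h_def inner_diff_right inner_add_right)
        have "card (G - {g}) = a" using G(2) finG g(1) by simp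
        then obtain q0 where q0: "q0 \<in> G - {g}" using a_pos
          by (metis card.empty ex_in_conv not_one_le_zero)
        have "x i + x j - 2 *\<^sub>R x q0 = (x i - x q0) + (x j - x q0)"
          by (simp add: scaleR_2)
        also have "\<dots> = (\<Sum>l\<in>G. (\<mu> i l + \<mu> j l) *\<^sub>R (x l - x q0))"
          using \<mu>[OF iI, of "x q0"] \<mu>[OF jI, of "x q0"] by (simp add: scaleR_left_distrib sum.distrib)
        finally have "0 = (\<Sum>l\<in>G. (\<mu> i l + \<mu> j l) * (u i j \<bullet> x l - h))"
          using x3[OF _ iI jI cq[OF q0]] q0 G(1) hq[OF q0]
          by (auto simp: inner_sum_right inner_diff_right)
        also have "\<dots> = (\<mu> i g + \<mu> j g) * (u i j \<bullet> x g - h) + (\<Sum>l\<in>G-{g}. (\<mu> i l + \<mu> j l) * (u i j \<bullet> x l - h))"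
          using g(1) finG by (simp add: sum.remove)
        also have "(\<Sum>l\<in>G-{g}. (\<mu> i l + \<mu> j l) * (u i j \<bullet> x l - h)) = 0"
          using hq by (intro sum.neutral) auto
        finally have "u i j \<bullet> x g = h" using nz by simp
        then have hG: "u i j \<bullet> x l = h" if "l \<in> G" for l using hq that by blast
        have hI: "u i j \<bullet> x l = h" if "l \<in> I" for l
        proof -
          have "u i j \<bullet> (x l - x q0) = (\<Sum>r\<in>G. \<mu> l r * (u i j \<bullet> x r - u i j \<bullet> x q0))"
            unfolding \<mu>[OF that, of "x q0"] by (simp add: inner_sum_right inner_diff_right)
          also have "\<dots> = 0" using hG q0 by (intro sum.neutral) auto
          finally show ?thesis using hG q0 by (simp add: inner_diff_right)
        qed
        show ?thesis using v hI ij(1) by (auto simp: A_def inner_diff_right)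
      qed
      have "dim (u i ` K) \<le> m - a" if i: "i \<in> K" for i
      proof -
        have iI: "i \<in> I" using i KI by blast
        \<comment> \<open>The orthogonal complement of \<open>span A\<close> within the span of the
          limit directions at \<open>i\<close>. Because \<open>span A\<close> is contained in that
          span, the dimension is smaller by exactly \<open>a\<close>.\<close>
        let ?O = "{y \<in> span (u i ` I). \<forall>v \<in> span A. orthogonal v y}"
        have "u i ` K \<subseteq> ?O"
        proof
          fix w assume "w \<in> u i ` K"
          then obtain j where j: "j \<in> K" "w = u i j" by blast
          have "orthogonal w v" if "v \<in> span A" for v
            using orth[OF i j(1)] j(2) that by (intro orthogonal_to_span[of v A w]) (auto simp: orthogonal_def)
          then show "w \<in> ?O" using j KI by (auto simp: orthogonal_commute intro: span_base)
        qed
        then have "dim (u i ` K) \<le> dim ?O" by (rule dim_subset)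
        moreover have "dim ?O + dim (span A) = dim (span (u i ` I))"
          by (rule dim_subspace_orthogonal_to_vectors) (auto intro: A_sub[OF iI, THEN subsetD])
        ultimately show ?thesis using less.prems(2)[OF iI] by (simp add: a_def dim_span)
      qed
      then show ?thesis
        using less.IH[of "m - a" K] a_pos am configuration_subset[OF less.prems(1) KI] less.prems(3)
        unfolding K_def by simp
    qed
    have "card I \<le> (2 * (a + 1) * \<kappa> ^ a) * ((2 * (m - a + 1)) ^ (m - a) * \<kappa> ^ (m - a))"
      using card_le_card_keys_times[OF fin finT keyT fiber] cardT by simp
    also have "\<dots> = (2 * (a + 1)) * (2 * (m - a + 1)) ^ (m - a) * (\<kappa> ^ a * \<kappa> ^ (m - a))"
      by (simp only: mult_ac)
    also have "\<dots> \<le> (2 * (m + 1)) ^ a * (2 * (m + 1)) ^ (m - a) * (\<kappa> ^ a * \<kappa> ^ (m - a))"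
    proof (intro mult_le_mono le_refl)
      \<comment> \<open>The choices of reference and sign are absorbed by the \<open>a\<close>
        factors \<open>2 * (m + 1)\<close>, of which there is at least one.\<close>
      have "2 * (a + 1) \<le> (2 * (m + 1)) ^ 1" using am by simp
      also have "\<dots> \<le> (2 * (m + 1)) ^ a" using a_pos by (intro power_increasing) auto
      finally show "2 * (a + 1) \<le> (2 * (m + 1)) ^ a" .
      show "(2 * (m - a + 1)) ^ (m - a) \<le> (2 * (m + 1)) ^ (m - a)" by (rule power_mono) auto
    qed
    also have "\<dots> = (2 * (m + 1)) ^ m * \<kappa> ^ m"
      using am by (simp only: flip: power_add) simp
    finally show ?thesis .
  qed
qed

section \<open>Extracting limit configurations by compactness\<close>

text \<open>The values \<open>t n\<close> may run off to infinity, but pairs can be assigned to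
  interval numbers in only finitely many ways, so one assignment recurs for infinitely many
  \<open>n\<close>. A further subsequence makes the directions converge. Exposing \<open>r\<close>
  lets properties of \<open>P (r n)\<close> such as flatness be carried along.\<close>

lemma nearly_k_distance_limit_configuration:
  fixes P :: "nat \<Rightarrow> 'a::euclidean_space set"
  assumes fin: "\<And>n. finite (P n)" and card: "\<And>n. card (P n) = M"
    and near: "\<And>n. nearly_k_distance (inverse (real (Suc n))) k (P n)"
  obtains r p c u where "strict_mono (r::nat \<Rightarrow> nat)" "\<And>n i. i < M \<Longrightarrow> p n i \<in> P (r n)"
    "configuration {..<M} p c (Suc k) u"
proof -
  have "\<exists>e. bij_betw e {..<M} (P n)" for n
    using ex_bij_betw_nat_finite[OF fin[of n]] card[of n] by (auto simp: lessThan_atLeast0)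
  then obtain e where e: "\<And>n. bij_betw (e n) {..<M} (P n)" by metis
  have eP: "e n i \<in> P n" if "i < M" for n i using bij_betwE[OF e[of n]] that by auto
  have e_inj: "e n i \<noteq> e n j" if "i < M" "j < M" "i \<noteq> j" for n i j
    using bij_betw_imp_inj_on[OF e[of n]] that by (auto dest: inj_onD)
  have "\<exists>t. \<forall>p1\<in>P n. \<forall>p2\<in>P n. p1 \<noteq> p2 \<longrightarrow>
      (\<exists>l<k. t l \<le> dist p1 p2 \<and> dist p1 p2 \<le> t l + inverse (real (Suc n)))" for n
    using near[of n] unfolding nearly_k_distance_def by blast
  then obtain t where t: "\<And>n p1 p2. p1 \<in> P n \<Longrightarrow> p2 \<in> P n \<Longrightarrow> p1 \<noteq> p2 \<Longrightarrow>
      \<exists>l<k. t n l \<le> dist p1 p2 \<and> dist p1 p2 \<le> t n l + inverse (real (Suc n))" by metis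
  define in_class where "in_class n i j l \<longleftrightarrow> l < k \<and> t n l \<le> dist (e n i) (e n j) \<and>
      dist (e n i) (e n j) \<le> t n l + inverse (real (Suc n))" for n i j l
  define cc where "cc n i j = (if i = j then k else SOME l. in_class n i j l)" for n i j
  have cc: "in_class n i j (cc n i j)" if "i < M" "j < M" "i \<noteq> j" for n i j
  proof -
    have "\<exists>l. in_class n i j l"
      using t[OF eP[OF that(1)] eP[OF that(2)] e_inj[OF that], of n] by (auto simp: in_class_def)
    then show ?thesis using that(3) by (simp add: cc_def someI_ex)
  qed
  have cc_self: "cc n i i = k" for n i by (simp add: cc_def)
  have cc_less: "cc n i j < Suc k" if "i < M" "j < M" for n i j
    using cc[OF that, of n] by (cases "i = j") (auto simp: cc_def in_class_def)
  \<comment> \<open>\<open>restrict\<close> makes the assignment an element of a finite function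
    space, ready for the pigeonhole principle.\<close>
  define F where "F n = restrict (\<lambda>(i,j). cc n i j) ({..<M} \<times> {..<M})" for n
  have "range F \<subseteq> PiE ({..<M} \<times> {..<M}) (\<lambda>_. {..<Suc k})"
  proof clarify
    fix n
    show "F n \<in> PiE ({..<M} \<times> {..<M}) (\<lambda>_. {..<Suc k})"
      unfolding F_def restrict_PiE_iff using cc_less by auto
  qed
  then have "finite (range F)" by (rule finite_subset) (auto intro: finite_PiE)
  then obtain n0 where inf: "infinite {n. F n = F n0}"
    using pigeonhole_infinite[of "UNIV :: nat set" F] by auto
  define r1 where "r1 = enumerate {n. F n = F n0}"
  have r1: "strict_mono r1" unfolding r1_def by (rule strict_mono_enumerate[OF inf])
  have Fr1: "F (r1 n) = F n0" for n
    using enumerate_in_set[OF inf, of n] by (simp add: r1_def)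
  have cc_const: "cc (r1 n) i j = cc n0 i j" if "i < M" "j < M" for n i j
    using fun_cong[OF Fr1[of n], of "(i,j)"] that by (simp add: F_def)
  define f where "f ij n = sgn (e (r1 n) (snd ij) - e (r1 n) (fst ij))" for ij n
  have bdd: "bounded (range (f ij))" for ij
    by (auto simp: bounded_iff f_def norm_sgn intro!: exI[of _ 1])
  have "\<exists>r l. strict_mono r \<and> (\<forall>ij\<in>{..<M} \<times> {..<M}. (\<lambda>n. f ij (r n)) \<longlonglongrightarrow> l ij)"
    by (rule finite_family_convergent_subseq) (simp_all add: bdd)
  then obtain r2 l where r2: "strict_mono r2"
    and l_pair: "\<forall>ij\<in>{..<M} \<times> {..<M}. (\<lambda>n. f ij (r2 n)) \<longlonglongrightarrow> l ij"
    by blast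
  have l: "(\<lambda>n. f (i,j) (r2 n)) \<longlonglongrightarrow> l (i,j)" if "i < M" "j < M" for i j
    using l_pair that by blast
  define r where "r = r1 \<circ> r2"
  have r: "strict_mono r" unfolding r_def by (rule strict_mono_o[OF r1 r2])
  have dist_lim: "(\<lambda>n. dist (e (r n) q) (e (r n) i) - dist (e (r n) q) (e (r n) j)) \<longlonglongrightarrow> 0"
    if qij: "q < M" "i < M" "j < M" and eq: "cc n0 q i = cc n0 q j" for q i j
  proof (cases "i = q \<or> j = q")
    case True
    \<comment> \<open>The name \<open>k\<close> occurs only on the diagonal, so \<open>q\<close>
      shares its own name with no other point.\<close>
    then have "i = q \<and> j = q"
      using eq cc[OF qij(1,2), of n0] cc[OF qij(1,3), of n0] cc_self[of n0 q]
      unfolding in_class_def by (metis less_irrefl)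
    then show ?thesis by simp
  next
    case False
    show ?thesis
    proof (rule Lim_null_comparison[OF always_eventually LIMSEQ_inverse_real_of_nat], intro allI)
      fix n
      have "in_class (r n) q i (cc n0 q i)" "in_class (r n) q j (cc n0 q i)"
        using cc[OF qij(1,2), of "r n"] cc[OF qij(1,3), of "r n"] False eq
          cc_const[OF qij(1,2)] cc_const[OF qij(1,3)] by (auto simp: r_def)
      then have "\<bar>dist (e (r n) q) (e (r n) i) - dist (e (r n) q) (e (r n) j)\<bar> \<le> inverse (real (Suc (r n)))"
        unfolding in_class_def by linarith
      also have "\<dots> \<le> inverse (real (Suc n))"
        using seq_suble[OF r, of n] by (intro le_imp_inverse_le) auto
      finally show "norm (dist (e (r n) q) (e (r n) i) - dist (e (r n) q) (e (r n) j)) \<le> inverse (real (Suc n))"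
        by simp
    qed
  qed
  have "configuration {..<M} (\<lambda>n. e (r n)) (cc n0) (Suc k) (\<lambda>i j. l (i,j))"
    unfolding configuration_def
  proof (intro conjI ballI allI impI)
    fix n i j assume "i \<in> {..<M}" "j \<in> {..<M}" "i \<noteq> j"
    then show "1 \<le> dist (e (r n) i) (e (r n) j)"
      using near[of "r n"] eP e_inj unfolding nearly_k_distance_def separated_def by simp
  next
    fix i j assume "i \<in> {..<M}" "j \<in> {..<M}"
    then show "(\<lambda>n. sgn (e (r n) j - e (r n) i)) \<longlonglongrightarrow> l (i, j)"
      using l by (simp add: f_def r_def)
  qed (use cc_less dist_lim in auto)
  then show ?thesis using that[of r "\<lambda>n. e (r n)"] r eP by blast
qed

section \<open>Flatness in the limit and the upper bounds\<close>

text \<open>A chord of the unit circle is no longer than its arc: the chord for the angle \<theta>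
  has length \<open>2 * sin (\<theta> / 2)\<close>. This converts angle bounds into norm
  bounds.\<close>

lemma norm_sgn_diff_le_vec_angle:
  fixes v w :: "'a::euclidean_space"
  assumes "v \<noteq> 0" "w \<noteq> 0"
  shows "norm (sgn v - sgn w) \<le> vec_angle v w"
proof -
  define \<theta> where "\<theta> = vec_angle v w"
  have "\<bar>v \<bullet> w\<bar> \<le> norm v * norm w" by (rule Cauchy_Schwarz_ineq2)
  then have bd: "-1 \<le> (v \<bullet> w) / (norm v * norm w)" "(v \<bullet> w) / (norm v * norm w) \<le> 1"
    using assms by (auto simp: divide_simps abs_le_iff)
  have \<theta>0: "0 \<le> \<theta>" unfolding \<theta>_def vec_angle_def using bd by (rule arccos_lbound)
  have cos: "cos \<theta> = sgn v \<bullet> sgn w"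
    unfolding \<theta>_def vec_angle_def using bd
    by (simp add: cos_arccos sgn_div_norm divide_inverse mult_ac)
  have "(norm (sgn v - sgn w))\<^sup>2 = (norm (sgn v))\<^sup>2 + (norm (sgn w))\<^sup>2 - 2 * (sgn v \<bullet> sgn w)"
    by (simp add: power2_norm_eq_inner inner_diff_left inner_diff_right inner_commute)
  also have "\<dots> = 2 - 2 * cos \<theta>" using assms by (simp add: norm_sgn cos)
  also have "\<dots> = (2 * sin (\<theta> / 2))\<^sup>2"
    using cos_double_sin[of "\<theta> / 2"] by (simp add: power_mult_distrib)
  also have "\<dots> \<le> \<theta>\<^sup>2"
    using abs_sin_x_le_abs_x[of "\<theta> / 2"] by (intro abs_le_square_iff[THEN iffD1]) simp
  finally show ?thesis using \<theta>0 unfolding \<theta>_def by (rule power2_le_imp_le)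
qed

text \<open>The unit normal of a hyperplane containing \<open>L\<close> is orthogonal to all
  directions of \<open>L\<close>, and a vector at small angle to \<open>L\<close> has its direction
  close to one of them. The factor 2 leaves room to pick such a direction without having to attain
  the infimum.\<close>

lemma vectors_flat_approx_normal:
  fixes V :: "'a::euclidean_space set"
  assumes flat: "vectors_flat (DIM('a) - 1) \<alpha> V L" and d: "DIM('a) \<ge> 2" and \<alpha>: "0 < \<alpha>"
  obtains \<nu> where "norm \<nu> = 1" "\<And>v. v \<in> V \<Longrightarrow> \<bar>\<nu> \<bullet> sgn v\<bar> \<le> 2 * \<alpha>"
proof -
  have dimL: "aff_dim L = int (DIM('a) - 1)" and L0: "L \<noteq> {}"
    using flat by (auto simp: vectors_flat_def is_plane_def)
  then have "aff_dim L < DIM('a)" using d by simp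
  then obtain a b where a: "a \<noteq> 0" "L \<subseteq> {x. a \<bullet> x = b}"
    using aff_lowdim_subset_hyperplane by metis
  define \<nu> where "\<nu> = sgn a"
  have \<nu>: "norm \<nu> = 1" using a by (simp add: \<nu>_def norm_sgn)
  have const: "\<nu> \<bullet> x = \<nu> \<bullet> y" if "x \<in> L" "y \<in> L" for x y
    using a(2) that by (auto simp: \<nu>_def sgn_div_norm)
  have perp: "\<nu> \<bullet> sgn (x - y) = 0" if "x \<in> L" "y \<in> L" for x y
    using const[OF that] by (simp add: sgn_div_norm[of "x - y"] inner_diff_right)
  obtain y0 where y0: "y0 \<in> L" using L0 by blast
  \<comment> \<open>Since \<open>DIM('a) \<ge> 2\<close>, \<open>L\<close> is more than a point, so
    the infimum runs over a nonempty set.\<close>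
  have "\<exists>x0\<in>L. x0 \<noteq> y0"
  proof (rule ccontr)
    assume "\<not> ?thesis"
    then have "L = {y0}" using y0 by blast
    then show False using dimL d by simp
  qed
  then obtain x0 where x0: "x0 \<in> L" "x0 \<noteq> y0" by blast
  have "\<bar>\<nu> \<bullet> sgn v\<bar> \<le> 2 * \<alpha>" if v: "v \<in> V" for v
  proof (cases "v = 0")
    case True
    then show ?thesis using \<alpha> by simp
  next
    case False
    let ?W = "{vec_angle v w | w. w \<in> {x - y | x y. x \<in> L \<and> y \<in> L} \<and> w \<noteq> 0}"
    have "Inf ?W < 2 * \<alpha>"
      using flat v False \<alpha> by (auto simp: vectors_flat_def angle_to_plane_def)
    moreover have "vec_angle v (x0 - y0) \<in> ?W"
      using x0 y0 by (intro CollectI exI[of _ "x0 - y0"]) auto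
    then have "?W \<noteq> {}" by blast
    ultimately obtain \<theta> where "\<theta> \<in> ?W" "\<theta> < 2 * \<alpha>" using cInf_lessD by meson
    then obtain x y where xy: "x \<in> L" "y \<in> L" "x - y \<noteq> 0" "vec_angle v (x - y) < 2 * \<alpha>"
      by auto
    have "\<bar>\<nu> \<bullet> sgn v\<bar> = \<bar>\<nu> \<bullet> (sgn v - sgn (x - y))\<bar>"
      using perp[OF xy(1,2)] by (simp add: inner_diff_right[of \<nu> "sgn v"])
    also have "\<dots> \<le> norm (sgn v - sgn (x - y))"
      using Cauchy_Schwarz_ineq2[of \<nu> "sgn v - sgn (x - y)"] \<nu> by simp
    also have "\<dots> \<le> vec_angle v (x - y)"
      using norm_sgn_diff_le_vec_angle[OF False xy(3)] .
    finally show ?thesis using xy(4) by simp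
  qed
  with \<nu> show ?thesis using that by blast
qed

lemma M_achievable_le:
  assumes "M_achievable k TYPE('a::euclidean_space) M"
  shows "M \<le> (2 * (DIM('a) + 1)) ^ DIM('a) * Suc k ^ DIM('a)"
proof -
  have "\<exists>P::'a set. finite P \<and> card P = M \<and> nearly_k_distance (inverse (real (Suc n))) k P" for n
    using assms unfolding M_achievable_def by simp
  then obtain P :: "nat \<Rightarrow> 'a set" where P: "\<And>n. finite (P n)" "\<And>n. card (P n) = M"
    "\<And>n. nearly_k_distance (inverse (real (Suc n))) k (P n)" by metis
  obtain r p c u where "strict_mono (r::nat \<Rightarrow> nat)"
    and conf: "configuration {..<M} p c (Suc k) (u :: nat \<Rightarrow> nat \<Rightarrow> 'a)"
    by (rule nearly_k_distance_limit_configuration[OF P])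
  show ?thesis
    using configuration_card_le[OF conf, of "DIM('a)"] by (simp add: dim_subset_UNIV)
qed

text \<open>At each point the approximate normals have a convergent subsequence, whose limit is a
  unit vector orthogonal to all limit directions there. So the counting bound applies with
  \<open>m = DIM('a) - 1\<close>.\<close>

lemma N_achievable_le:
  assumes ach: "N_achievable k TYPE('a::euclidean_space) N" and d: "DIM('a) \<ge> 2"
  shows "N \<le> (2 * DIM('a)) ^ (DIM('a) - 1) * Suc k ^ (DIM('a) - 1)"
proof -
  have "\<exists>P::'a set. finite P \<and> card P = N \<and> nearly_k_distance (inverse (real (Suc n))) k P \<and>
      flat_set (DIM('a) - 1) (inverse (real (Suc n))) P" for n
  proof -
    have "0 < inverse (real (Suc n))" by simp
    then show ?thesis using ach unfolding N_achievable_def by blast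
  qed
  then obtain P :: "nat \<Rightarrow> 'a set" where P: "\<And>n. finite (P n)" "\<And>n. card (P n) = N"
    "\<And>n. nearly_k_distance (inverse (real (Suc n))) k (P n)"
    and flat: "\<And>n. flat_set (DIM('a) - 1) (inverse (real (Suc n))) (P n)" by metis
  obtain r p c u where r: "strict_mono (r::nat \<Rightarrow> nat)" and pP: "\<And>n i. i < N \<Longrightarrow> p n i \<in> P (r n)"
    and conf: "configuration {..<N} p c (Suc k) (u :: nat \<Rightarrow> nat \<Rightarrow> 'a)"
    by (rule nearly_k_distance_limit_configuration[OF P]) blast
  have "dim (u i ` {..<N}) \<le> DIM('a) - 1" if i: "i \<in> {..<N}" for i
  proof -
    have "\<exists>\<nu>. norm \<nu> = 1 \<and> (\<forall>j<N. \<bar>\<nu> \<bullet> sgn (p n i - p n j)\<bar> \<le> 2 * inverse (real (Suc (r n))))" for n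
    proof -
      obtain L where L: "vectors_flat (DIM('a) - 1) (inverse (real (Suc (r n)))) {p n i - q |q. q \<in> P (r n)} L"
        using flat[of "r n"] pP[of i n] i unfolding flat_set_def by blast
      obtain \<nu> where "norm \<nu> = 1" 
        "\<And>v. v \<in> {p n i - q |q. q \<in> P (r n)} \<Longrightarrow> \<bar>\<nu> \<bullet> sgn v\<bar> \<le> 2 * inverse (real (Suc (r n)))"
        by (rule vectors_flat_approx_normal[OF L d]) (simp, blast)
      then show ?thesis using pP by blast
    qed
    then obtain \<nu> where \<nu>: "\<And>n. norm (\<nu> n) = 1"
      "\<And>n j. j < N \<Longrightarrow> \<bar>\<nu> n \<bullet> sgn (p n i - p n j)\<bar> \<le> 2 * inverse (real (Suc (r n)))" by metis
    have "bounded (range \<nu>)" using \<nu>(1) by (auto simp: bounded_iff intro!: exI[of _ 1])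
    then obtain \<nu>0 s where s: "strict_mono s" "(\<nu> \<circ> s) \<longlonglongrightarrow> \<nu>0"
      using bounded_imp_convergent_subsequence by blast
    have "norm \<nu>0 = 1"
      using tendsto_norm[OF s(2)] \<nu>(1) by (simp add: LIMSEQ_const_iff)
    then have \<nu>0: "\<nu>0 \<noteq> 0" by auto
    have "\<nu>0 \<bullet> u i j = 0" if j: "j \<in> {..<N}" for j
    proof -
      have "(\<lambda>n. sgn (p n j - p n i)) \<longlonglongrightarrow> u i j"
        using conf i j unfolding configuration_def by blast
      from LIMSEQ_subseq_LIMSEQ[OF this s(1)]
      have lim: "(\<lambda>n. \<nu> (s n) \<bullet> sgn (p (s n) j - p (s n) i)) \<longlonglongrightarrow> \<nu>0 \<bullet> u i j"
        using s(2) by (intro tendsto_inner) (simp_all add: o_def)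
      have "(\<lambda>n. \<nu> (s n) \<bullet> sgn (p (s n) j - p (s n) i)) \<longlonglongrightarrow> 0"
      proof (rule Lim_null_comparison[OF always_eventually], intro allI)
        fix n
        have "sgn (p (s n) j - p (s n) i) = - sgn (p (s n) i - p (s n) j)"
          by (metis minus_diff_eq sgn_minus)
        then have "norm (\<nu> (s n) \<bullet> sgn (p (s n) j - p (s n) i)) \<le> 2 * inverse (real (Suc (r (s n))))"
          using \<nu>(2)[of j "s n"] j by simp
        also have "\<dots> \<le> 2 * inverse (real (Suc n))"
          using seq_suble[OF r, of "s n"] seq_suble[OF s(1), of n]
          by (intro mult_left_mono le_imp_inverse_le) auto
        finally show "norm (\<nu> (s n) \<bullet> sgn (p (s n) j - p (s n) i)) \<le> 2 * inverse (real (Suc n))" .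
      qed (use tendsto_mult_left[OF LIMSEQ_inverse_real_of_nat, of 2] in simp)
      with lim show ?thesis by (rule LIMSEQ_unique)
    qed
    then have "u i ` {..<N} \<subseteq> {x. \<nu>0 \<bullet> x = 0}" by blast
    then show ?thesis using dim_subset dim_hyperplane[OF \<nu>0] by metis
  qed
  from configuration_card_le[OF conf this] show ?thesis using d by simp
qed

section \<open>Multiscale grids and the lower bounds\<close>

text \<open>Induction on the axes. The step length \<open>R\<close> of the new axis is chosen after
  the old grid, so large that the old coordinates change a distance by at most \<epsilon> once the
  new coordinates differ. A new axis thus costs only \<open>m\<close> further distances while
  multiplying the number of points by \<open>m + 1\<close>.\<close>

lemma multiscale_grid:
  fixes S :: "'a::euclidean_space set" and \<epsilon> :: real
  assumes "finite S" "S \<subseteq> Basis" "0 < \<epsilon>"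
  shows "\<exists>P T. finite P \<and> P \<subseteq> span S \<and> card P = (m + 1) ^ card S \<and> finite T \<and> card T \<le> m * card S \<and>
     (\<forall>t\<in>T. 1 \<le> t) \<and> (\<forall>x\<in>P. \<forall>y\<in>P. x \<noteq> y \<longrightarrow> (\<exists>t\<in>T. t \<le> dist x y \<and> dist x y \<le> t + \<epsilon>))"
  using assms
proof (induction S rule: finite_induct)
  case empty
  show ?case by (rule exI[of _ "{0}"], rule exI[of _ "{}"]) simp
next
  case (insert b S)
  then obtain P T where P: "finite P" "P \<subseteq> span S" "card P = (m + 1) ^ card S"
    and T: "finite T" "card T \<le> m * card S" "\<And>t. t \<in> T \<Longrightarrow> 1 \<le> t"
    and PT: "\<And>x y. x \<in> P \<Longrightarrow> y \<in> P \<Longrightarrow> x \<noteq> y \<Longrightarrow> \<exists>t\<in>T. t \<le> dist x y \<and> dist x y \<le> t + \<epsilon>"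
    by auto
  have b: "norm b = 1" using insert.prems by auto
  obtain \<Delta> where \<Delta>: "\<And>x y. x \<in> P \<Longrightarrow> y \<in> P \<Longrightarrow> dist x y \<le> \<Delta>"
    using finite_imp_bounded[OF P(1)] by (metis bounded_two_points)
  \<comment> \<open>For a step length \<open>D \<ge> R\<close> this gives \<open>D\<^sup>2 + \<Delta>\<^sup>2 \<le> (D + \<epsilon>)\<^sup>2\<close>.\<close>
  define R where "R = max 1 (\<Delta>\<^sup>2 / \<epsilon>)"
  have R1: "1 \<le> R" and R2: "\<Delta>\<^sup>2 \<le> R * \<epsilon>"
    using insert.prems(2) by (auto simp: R_def pos_divide_le_eq[symmetric])
  define g where "g = (\<lambda>(x, a). x + (real a * R) *\<^sub>R b)"
  have orth: "z \<bullet> b = 0" if "z \<in> span S" for z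
  proof -
    have "orthogonal b s" if "s \<in> S" for s
      using that insert.prems(1) insert.hyps(2) by (auto simp: orthogonal_def intro!: inner_not_same_Basis)
    from orthogonal_to_span[OF that this] show ?thesis
      by (simp add: orthogonal_def inner_commute)
  qed
  have dist2: "(dist (g (x,a)) (g (y,a')))\<^sup>2 = (dist x y)\<^sup>2 + (\<bar>real a - real a'\<bar> * R)\<^sup>2"
    if "x \<in> P" "y \<in> P" for x y a a'
  proof -
    have "g (x,a) - g (y,a') = (x - y) + ((real a - real a') * R) *\<^sub>R b"
      by (simp add: g_def algebra_simps)
    moreover have "(x - y) \<bullet> b = 0" using orth that P(2) span_diff by blast
    ultimately have "(norm (g (x,a) - g (y,a')))\<^sup>2 = (norm (x - y))\<^sup>2 + (norm (((real a - real a') * R) *\<^sub>R b))\<^sup>2"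
      using norm_add_Pythagorean[of "x - y" "((real a - real a') * R) *\<^sub>R b"]
      by (simp add: orthogonal_def)
    then show ?thesis using b R1 by (simp add: dist_norm power_mult_distrib)
  qed
  have inj: "inj_on g (P \<times> {..m})"
  proof (rule inj_onI, clarify)
    fix x a y a' assume "x \<in> P" "y \<in> P" "g (x,a) = g (y,a')"
    then have "(dist x y)\<^sup>2 + (\<bar>real a - real a'\<bar> * R)\<^sup>2 = 0" using dist2[of x y a a'] by simp
    then show "x = y \<and> a = a'" using R1 by (simp add: add_nonneg_eq_0_iff)
  qed
  let ?P = "g ` (P \<times> {..m})" and ?T = "T \<union> (\<lambda>j. real j * R) ` {1..m}"
  have "finite ?P" using P(1) by simp
  moreover have "?P \<subseteq> span (insert b S)"
  proof clarify
    fix x a assume "x \<in> P"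
    then have "x \<in> span (insert b S)" using P(2) span_mono[of S "insert b S"] by blast
    then show "g (x,a) \<in> span (insert b S)"
      by (simp add: g_def span_add span_base span_scale)
  qed
  moreover have "card ?P = (m + 1) ^ card (insert b S)"
    using insert.hyps P(3) by (simp add: card_image[OF inj] card_cartesian_product)
  moreover have "finite ?T" using T(1) by simp
  moreover have "card ?T \<le> m * card (insert b S)"
  proof -
    have "card ?T \<le> card T + card ((\<lambda>j. real j * R) ` {1..m})" by (rule card_Un_le)
    also have "\<dots> \<le> m * card S + m"
      using T(2) card_image_le[of "{1..m}" "\<lambda>j. real j * R"] by simp
    finally show ?thesis using insert.hyps by simp
  qed
  moreover have "\<forall>t\<in>?T. 1 \<le> t"
  proof
    fix t assume "t \<in> ?T"
    then show "1 \<le> t"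
    proof
      assume "t \<in> (\<lambda>j. real j * R) ` {1..m}"
      then obtain j where "1 \<le> j" "t = real j * R" by auto
      then show ?thesis using mult_mono[of 1 "real j" 1 R] R1 by simp
    qed (rule T(3))
  qed
  moreover have "\<exists>t\<in>?T. t \<le> dist (g (x,a)) (g (y,a')) \<and> dist (g (x,a)) (g (y,a')) \<le> t + \<epsilon>"
    if xy: "x \<in> P" "y \<in> P" and a: "a \<le> m" "a' \<le> m" and ne: "g (x,a) \<noteq> g (y,a')" for x y a a'
  proof (cases "a = a'")
    case True
    have "(dist (g (x,a)) (g (y,a')))\<^sup>2 = (dist x y)\<^sup>2" using dist2[OF xy] True by simp
    then have "dist (g (x,a)) (g (y,a')) = dist x y" by (rule power2_eq_imp_eq) simp_all
    then show ?thesis using PT[OF xy] ne True by auto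
  next
    case False
    define j where "j = nat \<bar>int a - int a'\<bar>"
    have j: "j \<in> {1..m}" "real j = \<bar>real a - real a'\<bar>" using a False by (auto simp: j_def)
    define D where "D = real j * R"
    have "R \<le> D" using j(1) R1 by (simp add: D_def mult_le_cancel_right1)
    have d2: "(dist (g (x,a)) (g (y,a')))\<^sup>2 = (dist x y)\<^sup>2 + D\<^sup>2"
      using dist2[OF xy] j(2) by (simp add: D_def)
    have "D \<le> dist (g (x,a)) (g (y,a'))"
      by (rule power2_le_imp_le) (simp_all add: d2)
    moreover have "dist (g (x,a)) (g (y,a')) \<le> D + \<epsilon>"
    proof (rule power2_le_imp_le)
      have "(dist x y)\<^sup>2 \<le> \<Delta>\<^sup>2" using \<Delta>[OF xy] by (intro power_mono) auto
      also have "\<dots> \<le> D * \<epsilon>"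
        using R2 \<open>R \<le> D\<close> insert.prems(2) by (meson mult_right_mono less_imp_le order_trans)
      also have "\<dots> \<le> 2 * D * \<epsilon> + \<epsilon>\<^sup>2" using R1 \<open>R \<le> D\<close> insert.prems(2) by simp
      finally show "(dist (g (x,a)) (g (y,a')))\<^sup>2 \<le> (D + \<epsilon>)\<^sup>2"
        unfolding d2 by (simp add: power2_sum)
      show "0 \<le> D + \<epsilon>" using R1 \<open>R \<le> D\<close> insert.prems(2) by simp
    qed
    ultimately show ?thesis using j(1) unfolding D_def by blast
  qed
  then have "\<forall>x\<in>?P. \<forall>y\<in>?P. x \<noteq> y \<longrightarrow> (\<exists>t\<in>?T. t \<le> dist x y \<and> dist x y \<le> t + \<epsilon>)"
    by (auto simp del: Un_iff)
  ultimately show ?case by blast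
qed

text \<open>The definition demands exactly \<open>k\<close> strictly increasing values, so
  \<open>T\<close> is padded with arbitrary further values at least 1 and sorted. Separation follows
  because every distance is at least some element of \<open>T\<close>.\<close>

lemma nearly_k_distanceI_finite:
  assumes T: "finite T" "card T \<le> k" "\<And>t. t \<in> T \<Longrightarrow> 1 \<le> t"
    and P: "\<And>x y. x \<in> P \<Longrightarrow> y \<in> P \<Longrightarrow> x \<noteq> y \<Longrightarrow> \<exists>t\<in>T. t \<le> dist x y \<and> dist x y \<le> t + \<epsilon>"
  shows "nearly_k_distance \<epsilon> k P"
proof -
  have "infinite ({1::real..} - T)" using T(1) infinite_Ici by (simp add: Diff_infinite_finite)
  then obtain T2 where T2: "T2 \<subseteq> {1..} - T" "finite T2" "card T2 = k - card T"
    using infinite_arbitrarily_large by blast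
  define A where "A = T \<union> T2"
  have A: "finite A" "\<And>t. t \<in> A \<Longrightarrow> 1 \<le> t"
    using T T2 by (auto simp: A_def)
  have "T \<inter> T2 = {}" using T2(1) by blast
  then have cardA: "card A = k" using T T2 by (simp add: A_def card_Un_disjoint)
  define t where "t i = sorted_list_of_set A ! i" for i
  have len: "length (sorted_list_of_set A) = k" using A(1) cardA by simp
  have tA: "t ` {..<k} = A"
    using set_conv_nth[of "sorted_list_of_set A"] A(1) len by (auto simp: t_def image_def)
  have "separated P"
    unfolding separated_def using P T(3) by (meson order_trans)
  moreover have "\<forall>i<k. 1 \<le> t i" using A(2) tA by blast
  moreover have "\<forall>i j. i < j \<and> j < k \<longrightarrow> t i < t j"
    using strict_sorted_list_of_set[of A] len by (simp add: t_def sorted_wrt_nth_less)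
  moreover have "\<exists>i<k. t i \<le> dist x y \<and> dist x y \<le> t i + \<epsilon>"
    if xy: "x \<in> P" "y \<in> P" "x \<noteq> y" for x y
  proof -
    obtain \<tau> where "\<tau> \<in> T" "\<tau> \<le> dist x y" "dist x y \<le> \<tau> + \<epsilon>"
      using P[OF xy] by blast
    moreover from this obtain i where "i < k" "\<tau> = t i" using tA A_def by blast
    ultimately show ?thesis by blast
  qed
  ultimately show ?thesis unfolding nearly_k_distance_def by blast
qed

text \<open>The budget of \<open>k\<close> distances is shared equally among the axes, with
  \<open>k div card S\<close> steps for each.\<close>

lemma ex_nearly_k_distance_in_span:
  fixes S :: "'a::euclidean_space set"
  assumes S: "S \<subseteq> Basis" and "0 < \<epsilon>"
  shows "\<exists>P. finite P \<and> P \<subseteq> span S \<and> card P = (k div card S + 1) ^ card S \<and> nearly_k_distance \<epsilon> k P"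
proof -
  have "finite S" using S finite_Basis finite_subset by blast
  from multiscale_grid[OF this S \<open>0 < \<epsilon>\<close>, of "k div card S"]
  obtain P T where PT: "finite P" "P \<subseteq> span S" "card P = (k div card S + 1) ^ card S"
      "finite T" "card T \<le> k div card S * card S" "\<forall>t\<in>T. 1 \<le> t"
      "\<forall>x\<in>P. \<forall>y\<in>P. x \<noteq> y \<longrightarrow> (\<exists>t\<in>T. t \<le> dist x y \<and> dist x y \<le> t + \<epsilon>)"
    by blast
  have "card T \<le> k" using PT(5) by (meson div_times_less_eq_dividend order_trans)
  then have "nearly_k_distance \<epsilon> k P"
    using PT(4,6,7) by (intro nearly_k_distanceI_finite[of T]) auto
  then show ?thesis using PT by blast
qed

text \<open>The single plane \<open>L\<close> serves all points: a nonzero difference of points of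
  \<open>P\<close> lies in \<open>L\<close> and makes angle 0 with itself.\<close>

lemma flat_set_subset_subspace:
  fixes P :: "'a::euclidean_space set"
  assumes "subspace L" "dim L = d" "P \<subseteq> L" "0 \<le> \<alpha>"
  shows "flat_set d \<alpha> P"
  unfolding flat_set_def
proof (intro ballI exI[of _ L])
  fix p assume p: "p \<in> P"
  have "is_plane d L"
    using assms(1,2) subspace_0[OF assms(1)]
    by (auto simp: is_plane_def subspace_imp_affine aff_dim_subspace)
  moreover have "angle_to_plane v L \<le> \<alpha>" if v: "v \<in> L" for v
  proof (cases "v = 0")
    case True
    then show ?thesis using assms(4) by (simp add: angle_to_plane_def)
  next
    case False
    let ?W = "{vec_angle v w | w. w \<in> {x - y | x y. x \<in> L \<and> y \<in> L} \<and> w \<noteq> 0}"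
    have "v = v - 0" by simp
    then have "v \<in> {x - y | x y. x \<in> L \<and> y \<in> L}" using v subspace_0[OF assms(1)] by blast
    moreover have "vec_angle v v = 0"
      using False by (simp add: vec_angle_def flip: power2_eq_square power2_norm_eq_inner)
    ultimately have "0 \<in> ?W" using False by force
    \<comment> \<open>A real infimum is known to lie below the elements only for a set bounded
      below. The bound 0 holds because an angle dominates a norm.\<close>
    moreover have "bdd_below ?W"
    proof (rule bdd_belowI)
      fix \<theta> assume "\<theta> \<in> ?W"
      then obtain w where "w \<noteq> 0" "\<theta> = vec_angle v w" by blast
      then show "0 \<le> \<theta>"
        using norm_sgn_diff_le_vec_angle[OF False] norm_ge_zero order_trans by metis
    qed
    ultimately have "Inf ?W \<le> 0" by (rule cInf_lower)
    then show ?thesis using False assms(4) by (simp add: angle_to_plane_def)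
  qed
  moreover have "p - q \<in> L" if "q \<in> P" for q
    using assms(1,3) p that by (auto intro: subspace_diff)
  ultimately show "vectors_flat d \<alpha> {p - q |q. q \<in> P} L"
    by (auto simp: vectors_flat_def)
qed

lemma M_achievable_grid:
  "M_achievable k TYPE('a::euclidean_space) ((k div DIM('a) + 1) ^ DIM('a))"
  unfolding M_achievable_def using ex_nearly_k_distance_in_span[OF order_refl, of _ k] by blast

lemma N_achievable_grid:
  "N_achievable k TYPE('a::euclidean_space) ((k div (DIM('a) - 1) + 1) ^ (DIM('a) - 1))"
proof -
  \<comment> \<open>All but one of the axes span a linear hyperplane, so the grid is flat for every
    \<alpha>.\<close>
  obtain S :: "'a set" where S: "S \<subseteq> Basis" "card S = DIM('a) - 1"
    by (metis diff_le_self obtain_subset_with_card_n)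
  have "independent S" using S(1) independent_Basis independent_mono by blast
  then have "dim (span S) = DIM('a) - 1" using S(2) by (simp add: dim_span dim_eq_card_independent)
  then have "flat_set (DIM('a) - 1) \<alpha> P" if "P \<subseteq> span S" "\<alpha> > 0" for P \<alpha>
    using that by (intro flat_set_subset_subspace[of "span S"]) auto
  then show ?thesis
    unfolding N_achievable_def using ex_nearly_k_distance_in_span[OF S(1), of _ k] S(2) by metis
qed

section \<open>Constants and assembly\<close>

text \<open>Rounding gives \<open>k \<le> (k div s + 1) * s\<close>. The denominator
  \<open>d ^ d\<close> dominates \<open>s ^ s\<close> for all \<open>s \<le> d\<close>, so one
  constant serves both exponents \<open>d\<close> and \<open>d - 1\<close>.\<close>

lemma power_le_Suc_div_power:
  assumes "0 < s" "s \<le> d"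
  shows "real k ^ s / real d ^ d \<le> real ((k div s + 1) ^ s)"
proof -
  have "k \<le> (k div s + 1) * s" using dividend_less_div_times[of s k] assms(1) by simp
  then have "real k \<le> real (k div s + 1) * real s" by (metis of_nat_le_iff of_nat_mult)
  then have "real k ^ s \<le> (real (k div s + 1) * real s) ^ s" by (intro power_mono) auto
  also have "\<dots> = real ((k div s + 1) ^ s) * real s ^ s" by (simp add: power_mult_distrib)
  also have "\<dots> \<le> real ((k div s + 1) ^ s) * real d ^ d"
  proof (intro mult_left_mono)
    have "real s ^ s \<le> real d ^ s" using assms by (intro power_mono) auto
    also have "\<dots> \<le> real d ^ d" using assms by (intro power_increasing) auto
    finally show "real s ^ s \<le> real d ^ d" .
  qed simp
  finally show ?thesis using assms by (simp add: divide_le_eq)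
qed

text \<open>\<open>GREATEST\<close> is a true maximum once the predicate holds somewhere and is
  bounded. The grids supply the witness \<open>n\<close>, the counting bounds supply
  \<open>B\<close>.\<close>

lemma Greatest_bounds:
  fixes B :: nat
  assumes "Q n" "\<And>m. Q m \<Longrightarrow> m \<le> B"
  shows "bdd_above {m. Q m}" "n \<le> (GREATEST m. Q m)" "(GREATEST m. Q m) \<le> B"
  using assms GreatestI_nat[of Q n B] Greatest_le_nat[of Q n B] by (auto intro!: bdd_aboveI)

text \<open>The \<open>bdd_above\<close> clauses make explicit that \<open>M_num\<close> and
  \<open>N_num\<close> are maxima of bounded sets and not unspecified values of
  \<open>GREATEST\<close>.\<close>

theorem theorem8:
  assumes "DIM('a::euclidean_space) \<ge> 2"
  shows "\<exists>c C::real. 0 < c \<and> c \<le> C \<and>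
    (\<forall>k\<ge>1. bdd_above {M. M_achievable k TYPE('a) M} \<and>
            bdd_above {N. N_achievable k TYPE('a) N} \<and>
            c * real k ^ DIM('a) \<le> real (M_num k TYPE('a)) \<and>
            real (M_num k TYPE('a)) \<le> C * real k ^ DIM('a) \<and>
            c * real k ^ (DIM('a) - 1) \<le> real (N_num k TYPE('a)) \<and>
            real (N_num k TYPE('a)) \<le> C * real k ^ (DIM('a) - 1))"
proof -
  define d where "d = DIM('a)"
  have d: "2 \<le> d" using assms by (simp add: d_def)
  define c where "c = 1 / real d ^ d"
  \<comment> \<open>The factor \<open>2 ^ d\<close> comes from \<open>Suc k \<le> 2 * k\<close> for
    \<open>k \<ge> 1\<close>. The other factor is the counting constant for \<open>m = d\<close>,
    which dominates the one for \<open>m = d - 1\<close>.\<close>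
  define C where "C = real ((2 * (d + 1)) ^ d * 2 ^ d)"
  have "c \<le> 1" using d by (simp add: c_def)
  moreover have "1 \<le> C" unfolding C_def by (simp only: real_of_nat_ge_one_iff) simp
  ultimately have "c \<le> C" by (rule order_trans)
  have "0 < c" using d by (simp add: c_def)
  have upper: "real x \<le> C * real k ^ s"
    if "x \<le> (2 * (s + 1)) ^ s * Suc k ^ s" "1 \<le> k" "s \<le> d" for x k s
  proof -
    note that(1)
    also have "(2 * (s + 1)) ^ s * Suc k ^ s \<le> (2 * (d + 1)) ^ d * (2 ^ d * k ^ s)"
    proof (rule mult_le_mono)
      have "(2 * (s + 1)) ^ s \<le> (2 * (d + 1)) ^ s" using that by (intro power_mono) auto
      also have "\<dots> \<le> (2 * (d + 1)) ^ d" using that by (intro power_increasing) auto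
      finally show "(2 * (s + 1)) ^ s \<le> (2 * (d + 1)) ^ d" .
      have "Suc k ^ s \<le> (2 * k) ^ s" using that by (intro power_mono) auto
      also have "\<dots> = 2 ^ s * k ^ s" by (rule power_mult_distrib)
      also have "\<dots> \<le> 2 ^ d * k ^ s" using that by (intro mult_le_mono1 power_increasing) auto
      finally show "Suc k ^ s \<le> 2 ^ d * k ^ s" .
    qed
    finally have "real x \<le> real ((2 * (d + 1)) ^ d * (2 ^ d * k ^ s))" by (simp only: of_nat_le_iff)
    also have "\<dots> = C * real k ^ s" by (simp add: C_def)
    finally show ?thesis .
  qed
  have lower: "c * real k ^ s \<le> real ((k div s + 1) ^ s)" if "0 < s" "s \<le> d" for k s
    using power_le_Suc_div_power[OF that, of k] by (simp add: c_def)
  show ?thesis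
  proof (rule exI[of _ c], rule exI[of _ C], intro conjI allI impI)
    show "0 < c" "c \<le> C" by fact+
  next
    fix k :: nat assume k: "1 \<le> k"
    have M: "bdd_above {M. M_achievable k TYPE('a) M}"
      "(k div DIM('a) + 1) ^ DIM('a) \<le> M_num k TYPE('a)"
      "M_num k TYPE('a) \<le> (2 * (DIM('a) + 1)) ^ DIM('a) * Suc k ^ DIM('a)"
      unfolding M_num_def
      by (rule Greatest_bounds[of "M_achievable k TYPE('a)", OF M_achievable_grid M_achievable_le], assumption)+
    have N: "bdd_above {N. N_achievable k TYPE('a) N}"
      "(k div (DIM('a) - 1) + 1) ^ (DIM('a) - 1) \<le> N_num k TYPE('a)"
      "N_num k TYPE('a) \<le> (2 * DIM('a)) ^ (DIM('a) - 1) * Suc k ^ (DIM('a) - 1)"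
      unfolding N_num_def
      by (rule Greatest_bounds[of "N_achievable k TYPE('a)", OF N_achievable_grid N_achievable_le[OF _ assms]], assumption)+
    show "bdd_above {M. M_achievable k TYPE('a) M}" "bdd_above {N. N_achievable k TYPE('a) N}"
      by (fact M(1) N(1))+
    have "c * real k ^ DIM('a) \<le> real ((k div DIM('a) + 1) ^ DIM('a))"
      using lower[of d k] d unfolding d_def by simp
    also have "\<dots> \<le> real (M_num k TYPE('a))" using M(2) by (simp only: of_nat_le_iff)
    finally show "c * real k ^ DIM('a) \<le> real (M_num k TYPE('a))" .
    show "real (M_num k TYPE('a)) \<le> C * real k ^ DIM('a)"
      using upper[OF M(3) k] by (simp add: d_def)
    have "c * real k ^ (DIM('a) - 1) \<le> real ((k div (DIM('a) - 1) + 1) ^ (DIM('a) - 1))"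
      using lower[of "d - 1" k] d unfolding d_def by simp
    also have "\<dots> \<le> real (N_num k TYPE('a))" using N(2) by (simp only: of_nat_le_iff)
    finally show "c * real k ^ (DIM('a) - 1) \<le> real (N_num k TYPE('a))" .
    \<comment> \<open>With \<open>s = d - 1\<close> the base \<open>2 * (s + 1)\<close> is
      \<open>2 * DIM('a)\<close>.\<close>
    show "real (N_num k TYPE('a)) \<le> C * real k ^ (DIM('a) - 1)"
      using upper[of "N_num k TYPE('a)" "d - 1" k] N(3) k d by (simp add: d_def)
  qed
qed

end
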